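(* Let $f(z)=z^d+c$ ($d\ge2$, $c\in\mathbb{C}$) have no attracting cycle in $\mathbb{C}$. Let $\bar x=\{x_{-n}\}_{n=0}^\infty$ be a backward orbit of $0$, i.e. $x_0=0$ and $f(x_{-n})=x_{-(n-1)}$ for $n>0$. Then $$\chi_-^{back}(f,\bar x):=\liminf_{n\to\infty}\frac1n\log|Df^n(x_{-n})|\ge 0.$$ *)

theory Defs
  imports "HOL-Analysis.Analysis" "HOL-Library.Extended_Real"
begin

definition unicrit :: "nat \<Rightarrow> complex \<Rightarrow> complex \<Rightarrow> complex" where
  "unicrit d c z = z ^ d + c"

definition has_attracting_cycle :: "(complex \<Rightarrow> complex) \<Rightarrow> bool" where
  "has_attracting_cycle f \<longleftrightarrow>
     (\<exists>z n. n > 0 \<and> (f ^^ n) z = z \<and> cmod (deriv (f ^^ n) z) < 1)"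

text \<open>Backward orbit of a point: x 0 = a and f (x (n+1)) = x n; x n stands for x_{-n}.\<close>
definition backward_orbit :: "(complex \<Rightarrow> complex) \<Rightarrow> complex \<Rightarrow> (nat \<Rightarrow> complex) \<Rightarrow> bool" where
  "backward_orbit f a x \<longleftrightarrow> x 0 = a \<and> (\<forall>n>0. f (x n) = x (n - 1))"

definition chi_back_lower :: "(complex \<Rightarrow> complex) \<Rightarrow> (nat \<Rightarrow> complex) \<Rightarrow> ereal" where
  "chi_back_lower f x =
     liminf (\<lambda>n. ereal (ln (cmod (deriv (f ^^ n) (x n))) / real n))"

end

(* The derivative of f^n along the backward orbit is bounded below by pulling discs back along it.
   An inverse branch g of f^j on a disc extends one step further unless g hits the critical value
   c. Without attracting cycles f^(j+1) never maps the closed disc of radius 2 rho about 0 into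
   its interior, so g omits a value within (2 rho)^d of c; a Koebe-type estimate then forces a
   hit to lie in a definite proportion of the disc away from its centre, as long as the orbit
   stays at distance at least rho from 0. Hence shrinking the disc by a constant factor at each
   time when the critical orbit returns near 0 keeps the pullback going, and these returns are
   rare for small rho because 0 is not periodic. Cutting the orbit at its successive closest
   approaches to 0 and applying the Koebe estimate once more to each block gives a lower bound
   of the form kappa exp(-eps n) for every eps > 0. *)

theory Submission
  imports Defs "HOL-Complex_Analysis.Great_Picard"
begin

section \<open>Distortion of univalent functions that omit a value\<close>

text \<open>The bound of Schottky's theorem for \<open>cmod (f 0) \<le> 1\<close> and \<open>cmod z \<le> 2 / 3\<close>.\<close>

definition schottky_const :: real where
  "schottky_const = exp (pi * exp (28 * pi))"

text \<open>Schottky's theorem needs two omitted values, while \<open>g - w\<close> omits only 0.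
  Passing to a square root turns injectivity of \<open>g\<close> into the second one.\<close>

lemma omitting_value_bound:
  fixes g :: "complex \<Rightarrow> complex"
  assumes r: "0 < r" and hol: "g holomorphic_on ball a r" and inj: "inj_on g (ball a r)"
    and w: "w \<notin> g ` ball a r" and z: "z \<in> cball a (r / 2)"
  shows "cmod (g z - w) \<le> schottky_const ^ 2 * cmod (g a - w)"
proof -
  obtain L where L: "L holomorphic_on ball a r" "\<And>x. x \<in> ball a r \<Longrightarrow> exp (L x) = g x - w"
  proof (rule holomorphic_logarithm_exists[of "ball a r" "\<lambda>x. g x - w" a])
    show "(\<lambda>x. g x - w) holomorphic_on ball a r" by (intro holomorphic_intros hol)
  qed (use w r in auto)
  have aw: "g a \<noteq> w" using w r by auto
  \<comment> \<open>A square root of the normalised function; it omits 0 and, by injectivity, also 1.\<close>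
  define k where "k = (\<lambda>x. - exp ((L x - L a) / 2))"
  have k_hol: "k holomorphic_on ball a r"
    unfolding k_def by (intro holomorphic_intros L) auto
  have k_sq: "k x ^ 2 = (g x - w) / (g a - w)" if "x \<in> ball a r" for x
  proof -
    have "k x ^ 2 = exp ((L x - L a) / 2 + (L x - L a) / 2)"
      unfolding k_def exp_add by (simp add: power2_eq_square)
    also have "\<dots> = exp (L x) / exp (L a)" by (simp flip: exp_diff)
    finally show ?thesis using L(2)[OF that] L(2)[of a] r by simp
  qed
  have ka: "k a = -1" by (simp add: k_def)
  \<comment> \<open>Squaring \<open>k x = 1\<close> gives \<open>g x = g a\<close>, hence
    \<open>x = a\<close>; but the minus sign in \<open>k\<close> makes
    \<open>k a = -1\<close>.\<close>
  have k01: "k x \<noteq> 0 \<and> k x \<noteq> 1" if "x \<in> ball a r" for x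
  proof -
    have "k x = 1 \<Longrightarrow> x = a"
      using k_sq[OF that] aw inj_onD[OF inj, of x a] that r by (simp add: field_simps)
    then show ?thesis using ka by (auto simp: k_def)
  qed
  \<comment> \<open>The scale \<open>3 / 4 * r\<close> keeps the closed unit disc inside
    \<open>ball a r\<close> and sends radius \<open>r / 2\<close> to (1/2)/(3/4) = 2/3.\<close>
  define q where "q = (\<lambda>\<zeta>. k (a + of_real (3 / 4 * r) * \<zeta>))"
  have sub: "a + of_real (3 / 4 * r) * \<zeta> \<in> ball a r" if "\<zeta> \<in> cball 0 1" for \<zeta>
  proof -
    have "cmod (of_real (3 / 4 * r) * \<zeta>) \<le> 3 / 4 * r"
      using that r by (simp add: norm_mult mult_left_le)
    then show ?thesis using r by (simp add: dist_norm)
  qed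
  have q_hol: "q holomorphic_on cball 0 1"
  proof -
    have "(k \<circ> (\<lambda>\<zeta>. a + of_real (3 / 4 * r) * \<zeta>)) holomorphic_on cball 0 1"
      by (rule holomorphic_on_compose_gen[OF _ k_hol]) (use sub in \<open>auto intro!: holomorphic_intros\<close>)
    then show ?thesis by (simp add: q_def o_def)
  qed
  define \<zeta> where "\<zeta> = (z - a) / of_real (3 / 4 * r)"
  have \<zeta>: "cmod \<zeta> \<le> 2 / 3"
  proof -
    have "cmod \<zeta> = cmod (z - a) / (3 / 4 * r)"
      using r unfolding \<zeta>_def norm_divide norm_of_real by simp
    also have "\<dots> \<le> (r / 2) / (3 / 4 * r)"
      using z r by (intro divide_right_mono) (auto simp: dist_norm norm_minus_commute)
    finally show ?thesis using r by simp
  qed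
  have "cmod (q \<zeta>) \<le> exp (pi * exp (pi * (2 + 2 * 1 + 12 * (2 / 3) / (1 - 2 / 3))))"
    by (rule Schottky[OF q_hol]) (use \<zeta> k01 sub in \<open>auto simp: q_def ka\<close>)
  also have "q \<zeta> = k z"
  proof -
    have "of_real (3 / 4 * r) \<noteq> (0 :: complex)" using r by simp
    then have "of_real (3 / 4 * r) * \<zeta> = z - a"
      unfolding \<zeta>_def times_divide_eq_right by (rule nonzero_mult_div_cancel_left)
    then show ?thesis by (simp only: q_def add_diff_cancel_left' add_diff_eq)
  qed
  finally have "cmod (k z) \<le> schottky_const"
    by (simp add: schottky_const_def mult.commute)
  then have "cmod (k z ^ 2) \<le> schottky_const ^ 2"
    by (simp add: norm_power power_mono)
  moreover have "z \<in> ball a r" using z r by simp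
  ultimately show ?thesis using aw by (simp add: k_sq norm_divide divide_simps)
qed

text \<open>The 4 comes from Cauchy's estimate on a circle of radius \<open>r / 4\<close>, the
  summand 1 from replacing \<open>g x - w\<close> by \<open>g x - g a\<close>.\<close>

definition koebe_const :: real where
  "koebe_const = 4 * (schottky_const ^ 2 + 1)"

lemma koebe_const_ge_1: "koebe_const \<ge> 1"
  using zero_le_power2[of schottky_const] by (simp add: koebe_const_def)

text \<open>A form of the Koebe quarter theorem, with a non-optimal constant.\<close>

lemma univalent_deriv_bound:
  fixes g :: "complex \<Rightarrow> complex"
  assumes r: "0 < r" and hol: "g holomorphic_on ball a r" and inj: "inj_on g (ball a r)"
    and w: "w \<notin> g ` ball a r" and \<xi>: "\<xi> \<in> ball a (r / 4)"
  shows "cmod (deriv g \<xi>) \<le> koebe_const * cmod (g a - w) / r"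
proof -
  define E where "E = schottky_const ^ 2"
  have near: "cball \<xi> (r / 4) \<subseteq> cball a (r / 2)"
  proof
    fix x assume "x \<in> cball \<xi> (r / 4)"
    then show "x \<in> cball a (r / 2)" using \<xi> dist_triangle[of a x \<xi>] by simp
  qed
  have sub: "cball \<xi> (r / 4) \<subseteq> ball a r"
    using near r by (force simp: subset_iff)
  have hol': "(\<lambda>x. g x - g a) holomorphic_on ball a r" by (intro holomorphic_intros hol)
  have bound: "cmod (g x - g a) \<le> (E + 1) * cmod (g a - w)" if "x \<in> cball \<xi> (r / 4)" for x
  proof -
    have "x \<in> cball a (r / 2)" using that near by blast
    then have "cmod (g x - w) \<le> E * cmod (g a - w)"
      unfolding E_def by (rule omitting_value_bound[OF r hol inj w])
    moreover have "cmod (g x - g a) \<le> cmod (g x - w) + cmod (g a - w)"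
      using norm_triangle_ineq4[of "g x - w" "g a - w"] by simp
    ultimately show ?thesis by (simp add: algebra_simps)
  qed
  have "cmod ((deriv ^^ 1) (\<lambda>x. g x - g a) \<xi>)
      \<le> fact 1 * ((E + 1) * cmod (g a - w)) / (r / 4) ^ 1"
  proof (rule Cauchy_inequality)
    show "(\<lambda>x. g x - g a) holomorphic_on ball \<xi> (r / 4)"
      using sub ball_subset_cball by (blast intro: holomorphic_on_subset[OF hol'])
    show "continuous_on (cball \<xi> (r / 4)) (\<lambda>x. g x - g a)"
      using sub by (intro holomorphic_on_imp_continuous_on holomorphic_on_subset[OF hol'])
  qed (use r bound in \<open>auto simp: dist_norm\<close>)
  moreover have "deriv (\<lambda>x. g x - g a) \<xi> = deriv g \<xi>"
    using hol sub r
    by (subst deriv_diff) (auto intro!: holomorphic_on_imp_differentiable_at[of g "ball a r"])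
  ultimately show ?thesis by (simp add: koebe_const_def E_def field_simps)
qed

lemma univalent_growth_bound:
  fixes g :: "complex \<Rightarrow> complex"
  assumes r: "0 < r" and hol: "g holomorphic_on ball a r" and inj: "inj_on g (ball a r)"
    and w: "w \<notin> g ` ball a r" and z: "z \<in> ball a (r / 4)"
  shows "cmod (g z - g a) \<le> koebe_const * cmod (g a - w) / r * cmod (z - a)"
proof -
  have "(g has_field_derivative deriv g \<xi>) (at \<xi> within ball a (r / 4))"
    if "\<xi> \<in> ball a (r / 4)" for \<xi>
    using that r
    by (auto intro!: has_field_derivative_at_within[OF holomorphic_derivI[OF hol]])
  from field_differentiable_bound[where f = g and f' = "deriv g", OF convex_ball this
      univalent_deriv_bound[OF r hol inj w] z, of a]
  show ?thesis using r by simp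
qed

section \<open>Iterates of entire functions and discs mapped into themselves\<close>

lemma holomorphic_funpow:
  assumes "g holomorphic_on UNIV"
  shows "g ^^ k holomorphic_on UNIV"
proof (induction k)
  case 0
  then show ?case by (simp add: id_def)
next
  case (Suc k)
  then show ?case using assms holomorphic_on_compose_gen[of "g ^^ k" UNIV g UNIV] by (simp add: o_def)
qed

lemma deriv_funpow_add:
  fixes g :: "complex \<Rightarrow> complex"
  assumes "g holomorphic_on UNIV"
  shows "deriv (g ^^ (m + n)) z = deriv (g ^^ m) ((g ^^ n) z) * deriv (g ^^ n) z"
proof -
  have "(g ^^ k) field_differentiable at x" for k x
    using holomorphic_funpow[OF assms] by (rule holomorphic_on_imp_differentiable_at) auto
  then show ?thesis unfolding funpow_add by (intro deriv_chain)
qed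

lemma deriv_funpow_fixpoint:
  fixes g :: "complex \<Rightarrow> complex"
  assumes "g holomorphic_on UNIV" "g z = z"
  shows "deriv (g ^^ k) z = deriv g z ^ k"
proof (induction k)
  case 0
  then show ?case by (simp add: id_def)
next
  case (Suc k)
  have "(g ^^ k) z = z" by (induction k) (simp_all add: assms(2))
  with Suc show ?case using deriv_funpow_add[OF assms(1), of 1 k z] by (simp add: o_def)
qed

text \<open>Brouwer's theorem gives the fixed point. The image of the closed disc is compact in the
  open disc, and the room left over yields the strict bound on the multiplier.\<close>

lemma contracted_disc_fixpoint:
  fixes F :: "complex \<Rightarrow> complex"
  assumes hol: "F holomorphic_on UNIV" and s: "0 < s" and F: "F ` cball 0 s \<subseteq> ball 0 s"
  obtains z where "F z = z" "cmod (deriv F z) < 1"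
proof -
  have cont: "continuous_on A F" for A
    using hol by (meson holomorphic_on_imp_continuous_on continuous_on_subset subset_UNIV)
  have "F \<in> cball 0 s \<rightarrow> cball 0 s" using F ball_subset_cball[of 0 s] by blast
  then obtain z where z: "z \<in> cball 0 s" "F z = z"
    using brouwer_ball[OF s cont] by blast
  then have zs: "cmod z < s" using F by force
  have "\<exists>x\<in>cball 0 s. \<forall>y\<in>cball 0 s. cmod (F y) \<le> cmod (F x)"
    using s by (intro continuous_attains_sup continuous_on_norm cont) auto
  then obtain x where x: "x \<in> cball 0 s" "\<And>y. y \<in> cball 0 s \<Longrightarrow> cmod (F y) \<le> cmod (F x)"
    by blast
  define s' where "s' = cmod (F x)"
  have s': "s' < s" using F x(1) by (force simp: s'_def)
  \<comment> \<open>The dilation moves \<open>F y\<close> by less than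
    \<open>\<eta> * (2 * s)\<close>, so this choice uses up exactly the gap
    \<open>s - s'\<close>.\<close>
  define \<eta> where "\<eta> = (s - s') / (2 * s)"
  have \<eta>: "\<eta> > 0" "\<eta> * (2 * s) = s - s'" using s s' by (auto simp: \<eta>_def)
  \<comment> \<open>A slight dilation of F about its fixed point still preserves the disc; bounding its iterates
     gives a derivative at most 1, hence strictly less than 1 for F itself.\<close>
  define G where "G = (\<lambda>y. z + of_real (1 + \<eta>) * (F y - z))"
  have G_hol: "G holomorphic_on UNIV" unfolding G_def by (intro holomorphic_intros hol)
  have G_ball: "G y \<in> ball 0 s" if "y \<in> ball 0 s" for y
  proof -
    have "G y = F y + of_real \<eta> * (F y - z)" by (simp add: G_def algebra_simps)
    then have "cmod (G y) \<le> cmod (F y) + \<eta> * (cmod (F y) + cmod z)"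
      using \<eta>(1) norm_triangle_ineq[of "F y" "of_real \<eta> * (F y - z)"] norm_triangle_ineq4[of "F y" z]
      by (smt (verit, best) mult_left_mono norm_mult norm_of_real)
    also have "\<dots> < s' + \<eta> * (s + s)"
      using x(2)[of y] that \<eta> zs s' by (intro add_le_less_mono mult_strict_left_mono) (auto simp: s'_def)
    also have "\<dots> = s" using \<eta> by simp
    finally show ?thesis by simp
  qed
  have Gz: "G z = z" by (simp add: G_def z)
  have "(F has_field_derivative deriv F z) (at z)"
    using hol by (rule holomorphic_derivI) auto
  then have "(G has_field_derivative of_real (1 + \<eta>) * deriv F z) (at z)"
    unfolding G_def by (auto intro!: derivative_eq_intros)
  then have dG: "deriv G z = of_real (1 + \<eta>) * deriv F z" by (rule DERIV_imp_deriv)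
  define \<rho> where "\<rho> = (s - cmod z) / 2"
  have \<rho>: "\<rho> > 0" "cball z \<rho> \<subseteq> ball 0 s"
  proof -
    show "\<rho> > 0" using zs by (simp add: \<rho>_def)
    show "cball z \<rho> \<subseteq> ball 0 s"
    proof
      fix y assume "y \<in> cball z \<rho>"
      then show "y \<in> ball 0 s" using zs norm_triangle_sub[of y z]
        by (simp add: \<rho>_def dist_norm norm_minus_commute field_simps)
    qed
  qed
  have iter: "(G ^^ k) y \<in> ball 0 s" if "y \<in> ball 0 s" for y k
    by (induction k) (use that G_ball in auto)
  have pw: "cmod (deriv G z) ^ k \<le> s / \<rho>" for k
  proof -
    have "cmod ((deriv ^^ 1) (G ^^ k) z) \<le> fact 1 * s / \<rho> ^ 1"
    proof (rule Cauchy_inequality)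
      show "G ^^ k holomorphic_on ball z \<rho>"
        using holomorphic_funpow[OF G_hol] by (rule holomorphic_on_subset) simp
      show "continuous_on (cball z \<rho>) (G ^^ k)"
        by (rule holomorphic_on_imp_continuous_on, rule holomorphic_on_subset[OF holomorphic_funpow[OF G_hol]]) simp
      show "cmod ((G ^^ k) y) \<le> s" if "cmod (z - y) = \<rho>" for y
        using iter[of y k] \<rho>(2) that by (force simp: dist_norm)
    qed (use \<rho> in auto)
    then show ?thesis using deriv_funpow_fixpoint[OF G_hol Gz, of k] by (simp add: norm_power)
  qed
  have "cmod (deriv G z) \<le> 1"
  proof (rule ccontr)
    assume "\<not> ?thesis"
    then obtain k where "s / \<rho> < cmod (deriv G z) ^ k" using real_arch_pow[of "cmod (deriv G z)"] by auto
    then show False using pw[of k] by simp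
  qed
  then have "(1 + \<eta>) * cmod (deriv F z) \<le> 1" using \<eta> by (simp add: dG norm_mult flip: of_real_add)
  then have "cmod (deriv F z) < 1"
    using \<eta>(1) mult_left_mono[of 1 "cmod (deriv F z)" "1 + \<eta>"] by argo
  then show thesis using that z by blast
qed

section \<open>The unicritical map without attracting cycles\<close>

locale unicritical =
  fixes d :: nat and c :: complex
  assumes d_ge_2: "d \<ge> 2"
    and no_attracting: "\<not> has_attracting_cycle (unicrit d c)"
begin

abbreviation f :: "complex \<Rightarrow> complex" where
  "f \<equiv> unicrit d c"

lemma f_holomorphic: "f holomorphic_on UNIV"
  unfolding unicrit_def by (intro holomorphic_intros)

lemmas funpow_holomorphic = holomorphic_funpow[OF f_holomorphic]
lemmas deriv_iterate_add = deriv_funpow_add[OF f_holomorphic]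

lemma funpow_f_shift: "(f ^^ Suc j) z = (f ^^ j) (f z)"
  by (simp add: funpow_swap1)

lemma deriv_f: "deriv f z = of_nat d * z ^ (d - 1)"
  unfolding unicrit_def by (rule DERIV_imp_deriv) (auto intro!: derivative_eq_intros)

lemma f_zero: "f 0 = c"
  using d_ge_2 by (simp add: unicrit_def zero_power)

lemma norm_f_minus_c: "cmod (f z - c) = cmod z ^ d"
  by (simp add: unicrit_def norm_power)

text \<open>A cycle through the critical point has multiplier 0 and would be attracting.\<close>

lemma critical_point_not_periodic:
  assumes "m > 0"
  shows "(f ^^ m) 0 \<noteq> 0"
proof
  assume per: "(f ^^ m) 0 = 0"
  obtain j where m: "m = j + 1" using assms by (cases m) auto
  have "deriv (f ^^ m) 0 = deriv (f ^^ j) ((f ^^ 1) 0) * deriv (f ^^ 1) 0"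
    unfolding m by (rule deriv_iterate_add)
  also have "deriv (f ^^ 1) 0 = 0" using d_ge_2 by (simp add: deriv_f)
  finally have "cmod (deriv (f ^^ m) 0) < 1" by simp
  then show False
    using no_attracting per assms unfolding has_attracting_cycle_def by blast
qed

lemma disc_not_contracted:
  assumes "m > 0" "s > 0"
  obtains v where "v \<in> cball 0 s" "(f ^^ m) v \<notin> ball 0 s"
proof -
  have "\<not> (f ^^ m) ` cball 0 s \<subseteq> ball 0 s"
  proof
    assume "(f ^^ m) ` cball 0 s \<subseteq> ball 0 s"
    then obtain z where "(f ^^ m) z = z" "cmod (deriv (f ^^ m) z) < 1"
      using contracted_disc_fixpoint[OF funpow_holomorphic \<open>s > 0\<close>] by blast
    then show False
      using no_attracting assms unfolding has_attracting_cycle_def by blast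
  qed
  then show thesis using that by blast
qed

section \<open>Inverse branches along orbits that stay away from the critical point\<close>

definition inverse_branch :: "(complex \<Rightarrow> complex) \<Rightarrow> nat \<Rightarrow> complex \<Rightarrow> real \<Rightarrow> bool" where
  "inverse_branch g j b r \<longleftrightarrow>
     g holomorphic_on ball b r \<and> (\<forall>\<zeta>\<in>ball b r. (f ^^ j) (g \<zeta>) = \<zeta>)"

lemma inverse_branch_inj:
  assumes "inverse_branch g j b r"
  shows "inj_on g (ball b r)"
  using assms by (intro inj_on_inverseI[where g = "f ^^ j"]) (auto simp: inverse_branch_def)

text \<open>Converts upper bounds on the derivative of a branch into lower bounds on that of the
  iterate.\<close>

lemma inverse_branch_deriv:
  assumes "inverse_branch g j b r" "r > 0"
  shows "deriv (f ^^ j) (g b) * deriv g b = 1"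
proof -
  have g: "(g has_field_derivative deriv g b) (at b)"
    using assms by (auto simp: inverse_branch_def intro: holomorphic_derivI[of g "ball b r"])
  have F: "(f ^^ j has_field_derivative deriv (f ^^ j) (g b)) (at (g b))"
    using funpow_holomorphic by (rule holomorphic_derivI) auto
  have "((f ^^ j) \<circ> g has_field_derivative deriv (f ^^ j) (g b) * deriv g b) (at b)"
    by (rule DERIV_chain[OF F g])
  moreover have "eventually (\<lambda>x. x \<in> ball b r) (nhds b)"
    using assms(2) by (intro eventually_nhds_in_open) auto
  then have "eventually (\<lambda>x. ((f ^^ j) \<circ> g) x = x) (nhds b)"
    by eventually_elim (use assms in \<open>auto simp: inverse_branch_def\<close>)
  ultimately have "((\<lambda>x. x) has_field_derivative deriv (f ^^ j) (g b) * deriv g b) (at b)"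
    by (subst (asm) DERIV_cong_ev[OF refl _ refl]) auto
  then show ?thesis using DERIV_ident DERIV_unique by blast
qed

text \<open>If the image of the branch contained the image of the disc of radius 2\<rho>, then
  that disc would be mapped into itself by the next iterate.\<close>

lemma inverse_branch_omits:
  assumes br: "inverse_branch g j b r" and \<rho>: "0 < \<rho>" "r \<le> \<rho>" "cmod b \<le> \<rho>"
  obtains w where "w \<notin> g ` ball b r" "cmod (w - c) \<le> 2 ^ d * \<rho> ^ d"
proof -
  \<comment> \<open>The radius is \<open>2 * \<rho>\<close> because the disc of that radius about 0
    contains \<open>ball b r\<close>; the omitted value will be \<open>f v\<close>.\<close>
  obtain v where v: "v \<in> cball 0 (2 * \<rho>)" "(f ^^ Suc j) v \<notin> ball 0 (2 * \<rho>)"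
    using disc_not_contracted[of "Suc j" "2 * \<rho>"] \<rho> by auto
  have "f v \<notin> g ` ball b r"
  proof
    assume "f v \<in> g ` ball b r"
    then have "(f ^^ Suc j) v \<in> ball b r"
      using br by (auto simp: inverse_branch_def funpow_swap1)
    then have "cmod ((f ^^ Suc j) v) < 2 * \<rho>"
      using \<rho> norm_triangle_sub[of "(f ^^ Suc j) v" b] by (simp add: dist_norm norm_minus_commute)
    then show False using v by simp
  qed
  moreover have "cmod (f v - c) \<le> (2 * \<rho>) ^ d"
    unfolding norm_f_minus_c using v by (intro power_mono) auto
  ultimately show thesis using that by (simp add: power_mult_distrib)
qed

text \<open>The loss of radius at one return. Its size brings the final estimate of
  \<open>critical_value_far\<close> down to \<open>\<rho> ^ d / 4\<close>, and being at least 8 it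
  puts \<open>b\<close> in the quarter disc where the growth bound applies.\<close>

definition shrink :: real where
  "shrink = 8 * koebe_const * 2 ^ d"

lemma shrink_ge_8: "shrink \<ge> 8"
  using mult_mono[of 1 koebe_const 1 "2 ^ d"] koebe_const_ge_1 by (simp add: shrink_def)

text \<open>Recentre the branch at the hit \<open>u\<close>, where its value is \<open>c\<close>. A
  value omitted near \<open>c\<close> makes the branch vary slowly around \<open>u\<close>, so a
  \<open>b\<close> too close to \<open>u\<close> would have \<open>g b\<close> too close to
  \<open>c\<close>.\<close>

lemma critical_value_far:
  assumes br: "inverse_branch g j b r" and \<rho>: "0 < \<rho>" "0 < r" "r \<le> \<rho>" "cmod b \<le> \<rho>"
    and far: "\<rho> ^ d \<le> cmod (g b - c)" and u: "u \<in> ball b r" "g u = c"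
  shows "r / shrink \<le> cmod (u - b)"
proof (rule ccontr)
  assume "\<not> ?thesis"
  then have close: "cmod (u - b) < r / shrink" by simp
  have A: "shrink > 0" using shrink_ge_8 by simp
  have k: "koebe_const > 0" using koebe_const_ge_1 by simp
  have "r / shrink \<le> r / 8" using shrink_ge_8 \<rho> by (intro divide_left_mono) auto
  with close have u8: "cmod (u - b) < r / 8" by (rule less_le_trans)
  have sub: "ball u (r / 2) \<subseteq> ball b r"
  proof
    fix x assume "x \<in> ball u (r / 2)"
    then show "x \<in> ball b r" using u8 dist_triangle[of b x u] \<rho> by (simp add: dist_norm norm_minus_commute)
  qed
  obtain w where w: "w \<notin> g ` ball b r" "cmod (w - c) \<le> 2 ^ d * \<rho> ^ d"
    using inverse_branch_omits[OF br] \<rho> by blast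
  have "\<rho> ^ d \<le> cmod (g b - g u)" using far u by simp
  also have "\<dots> \<le> koebe_const * cmod (g u - w) / (r / 2) * cmod (b - u)"
  proof (rule univalent_growth_bound)
    show "g holomorphic_on ball u (r / 2)"
      using br sub unfolding inverse_branch_def by (meson holomorphic_on_subset)
    show "inj_on g (ball u (r / 2))"
      using inverse_branch_inj[OF br] sub by (rule inj_on_subset)
    show "b \<in> ball u (r / 2 / 4)" using u8 by (simp add: dist_norm)
  qed (use \<rho> w sub in auto)
  also have "\<dots> \<le> koebe_const * (2 ^ d * \<rho> ^ d) / (r / 2) * cmod (b - u)"
    using k \<rho> w(2) u(2)
    by (intro mult_right_mono divide_right_mono mult_left_mono) (auto simp: norm_minus_commute)
  also have "\<dots> < koebe_const * (2 ^ d * \<rho> ^ d) / (r / 2) * (r / shrink)"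
    using k \<rho> close by (intro mult_strict_left_mono) (auto simp: norm_minus_commute)
  also have "\<dots> = \<rho> ^ d / 4"
    using k \<rho> by (simp add: shrink_def)
  finally show False using \<rho> by simp
qed

text \<open>These are the only times at which the pullback can meet the critical value: a hit at
  \<open>u\<close> when extending from \<open>j\<close> to \<open>Suc j\<close> forces
  \<open>u = (f ^^ Suc j) 0\<close>.\<close>

definition returns :: "real \<Rightarrow> nat \<Rightarrow> nat" where
  "returns \<rho> j = card {i \<in> {1..j}. cmod ((f ^^ i) 0) < 2 * \<rho>}"

lemma returns_Suc:
  "returns \<rho> (Suc j) = returns \<rho> j + (if cmod ((f ^^ Suc j) 0) < 2 * \<rho> then 1 else 0)"
proof -
  have "{i \<in> {1..Suc j}. cmod ((f ^^ i) 0) < 2 * \<rho>} =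
    {i \<in> {1..j}. cmod ((f ^^ i) 0) < 2 * \<rho>} \<union>
    (if cmod ((f ^^ Suc j) 0) < 2 * \<rho> then {Suc j} else {})"
    by (auto simp: le_Suc_eq)
  then show ?thesis
    unfolding returns_def by (simp del: funpow.simps)
qed

text \<open>Induction peeling off the first iterate: a branch \<open>h\<close> ending at
  \<open>f z\<close> is followed by a d-th root of \<open>h - c\<close>, which exists on a disc
  where \<open>h\<close> misses \<open>c\<close>.\<close>

lemma exists_inverse_branch:
  assumes "0 < \<rho>" "cmod ((f ^^ j) z) \<le> \<rho>" "\<And>i. i < j \<Longrightarrow> \<rho> \<le> cmod ((f ^^ i) z)"
  obtains g where "inverse_branch g j ((f ^^ j) z) (\<rho> / shrink ^ returns \<rho> j)" "g ((f ^^ j) z) = z"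
proof -
  have "\<exists>g. inverse_branch g j ((f ^^ j) z) (\<rho> / shrink ^ returns \<rho> j) \<and> g ((f ^^ j) z) = z"
    using assms(2,3)
  proof (induction j arbitrary: z)
    case 0
    show ?case by (rule exI[of _ "\<lambda>x. x"]) (simp add: inverse_branch_def)
  next
    case (Suc j)
    define b where "b = (f ^^ j) (f z)"
    have b: "(f ^^ Suc j) z = b" unfolding b_def by (rule funpow_f_shift)
    define r where "r = \<rho> / shrink ^ returns \<rho> j"
    define r' where "r' = \<rho> / shrink ^ returns \<rho> (Suc j)"
    have A: "shrink \<ge> 1" using shrink_ge_8 by simp
    have r: "0 < r" "r \<le> \<rho>" using A assms(1) by (simp_all add: r_def divide_le_eq mult_le_cancel_left1)
    have r': "0 < r'" using A assms(1) by (simp add: r'_def)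
    have b_le: "cmod b \<le> \<rho>" using Suc.prems(1) b by simp
    have z_ge: "\<rho> \<le> cmod z" using Suc.prems(2)[of 0] by simp
    have "\<exists>g. inverse_branch g j ((f ^^ j) (f z)) r \<and> g ((f ^^ j) (f z)) = f z"
      unfolding r_def
    proof (rule Suc.IH)
      show "\<rho> \<le> cmod ((f ^^ i) (f z))" if "i < j" for i
        using Suc.prems(2)[of "Suc i"] that by (simp only: funpow_f_shift Suc_less_eq)
    qed (use b_le b_def in simp)
    then obtain h where h: "inverse_branch h j b r" "h b = f z"
      unfolding b_def by blast
    have r'_eq: "r' = (if cmod ((f ^^ Suc j) 0) < 2 * \<rho> then r / shrink else r)"
      by (simp add: r_def r'_def returns_Suc del: funpow.simps)
    have r'_le: "r' \<le> r" using A r by (simp add: r'_eq divide_le_eq mult_le_cancel_left1 del: funpow.simps)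
    \<comment> \<open>A hit makes time \<open>Suc j\<close> a counted return, so the radius has
      already been divided by \<open>shrink\<close>, and \<open>critical_value_far\<close> places
      \<open>u\<close> outside the smaller disc.\<close>
    have no_hit: "h u \<noteq> c" if "u \<in> ball b r'" for u
    proof
      assume hu: "h u = c"
      have u: "u \<in> ball b r" using that r'_le by simp
      have "(f ^^ Suc j) 0 = (f ^^ j) (h u)"
        unfolding funpow_f_shift hu f_zero ..
      also have "\<dots> = u" using h(1) u by (simp add: inverse_branch_def)
      finally have "cmod ((f ^^ Suc j) 0) < 2 * \<rho>"
        using u r b_le norm_triangle_sub[of u b] by (simp add: dist_norm norm_minus_commute)
      then have "r' = r / shrink" by (simp only: r'_eq if_True)
      moreover have "r / shrink \<le> cmod (u - b)"
      proof (rule critical_value_far[OF h(1) assms(1) r b_le _ u hu])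
        show "\<rho> ^ d \<le> cmod (h b - c)"
          unfolding h(2) norm_f_minus_c using z_ge assms(1) by (intro power_mono) auto
      qed
      ultimately show False using that by (simp add: dist_norm norm_minus_commute)
    qed
    have hol: "(\<lambda>x. h x - c) holomorphic_on ball b r'"
      using h(1) r'_le unfolding inverse_branch_def
      by (intro holomorphic_intros holomorphic_on_subset[of h "ball b r" "ball b r'"]) auto
    obtain L where L: "L holomorphic_on ball b r'" "\<And>x. x \<in> ball b r' \<Longrightarrow> exp (L x) = h x - c"
    proof (rule holomorphic_logarithm_exists[of "ball b r'" "\<lambda>x. h x - c" b])
    qed (use hol no_hit r' in auto)
    \<comment> \<open>The d-th root of \<open>h - c\<close> normalised to take the value
      \<open>z\<close> at \<open>b\<close>.\<close>
    define g where "g = (\<lambda>x. z * exp ((L x - L b) / of_nat d))"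
    have "g x ^ d = h x - c" if "x \<in> ball b r'" for x
    proof -
      have "exp ((L x - L b) / of_nat d) ^ d = exp (of_nat d * ((L x - L b) / of_nat d))"
        by (rule exp_of_nat_mult[symmetric])
      also have "\<dots> = exp (L x) / exp (L b)"
        using d_ge_2 by (simp add: exp_diff)
      also have "\<dots> = (h x - c) / z ^ d"
        using L(2)[OF that] L(2)[of b] r' h(2) by (simp add: unicrit_def)
      finally show ?thesis using z_ge assms(1) by (auto simp: g_def power_mult_distrib)
    qed
    then have fg: "f (g x) = h x" if "x \<in> ball b r'" for x
      using that by (simp add: unicrit_def)
    have "inverse_branch g (Suc j) b r'"
      unfolding inverse_branch_def
    proof (intro conjI ballI)
      show "g holomorphic_on ball b r'"
        unfolding g_def using d_ge_2 by (intro holomorphic_intros L) auto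
      show "(f ^^ Suc j) (g x) = x" if "x \<in> ball b r'" for x
        using fg[OF that] h(1) r'_le that unfolding funpow_f_shift by (auto simp: inverse_branch_def)
    qed
    moreover have "g b = z" by (simp add: g_def)
    ultimately show ?case unfolding b r'_def by blast
  qed
  then show thesis using that by blast
qed

section \<open>Derivative bounds for single blocks of an orbit\<close>

definition escape_radius :: real where
  "escape_radius = 2 + cmod c"

lemma escape_radius_ge_2: "escape_radius \<ge> 2"
  by (simp add: escape_radius_def)

text \<open>Beyond this radius the modulus at least doubles.\<close>

lemma escape_step:
  assumes "escape_radius < cmod z"
  shows "escape_radius < cmod (f z)"
proof -
  have z: "2 + cmod c < cmod z" using assms by (simp add: escape_radius_def)
  have "cmod z * (2 + cmod c) \<le> cmod z * cmod z" using z by (intro mult_left_mono) auto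
  also have "\<dots> = cmod z ^ 2" by (simp add: power2_eq_square)
  also have "\<dots> \<le> cmod z ^ d"
    using z d_ge_2 norm_ge_zero[of c] by (intro power_increasing) linarith+
  also have "\<dots> \<le> cmod (f z) + cmod c"
    using norm_triangle_ineq4[of "f z" c] by (simp add: unicrit_def norm_power)
  finally have "cmod z * (2 + cmod c) \<le> cmod (f z) + cmod c" .
  moreover have "1 * cmod c \<le> cmod z * cmod c"
    using z norm_ge_zero[of c] by (intro mult_right_mono) linarith+
  ultimately have "2 * cmod z \<le> cmod (f z)" by (simp add: algebra_simps)
  then show ?thesis using z norm_ge_zero[of z] unfolding escape_radius_def by linarith
qed

lemma escape_iterate:
  assumes "escape_radius < cmod z"
  shows "escape_radius < cmod ((f ^^ j) z)"
  by (induction j) (simp_all add: assms escape_step)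

text \<open>Points beyond the escape radius never come back near 0, so the inverse branch is bounded
  and Cauchy's estimate controls its derivative.\<close>

lemma deriv_lower_bound_far:
  assumes \<rho>: "0 < \<rho>" "\<rho> \<le> 1" and end_le: "cmod ((f ^^ j) z) \<le> \<rho>"
    and far: "\<And>i. i < j \<Longrightarrow> \<rho> \<le> cmod ((f ^^ i) z)"
  shows "\<rho> / (2 * escape_radius) / shrink ^ returns \<rho> j \<le> cmod (deriv (f ^^ j) z)"
proof -
  define b where "b = (f ^^ j) z"
  define r where "r = \<rho> / shrink ^ returns \<rho> j"
  have A: "shrink \<ge> 1" using shrink_ge_8 by simp
  have r: "0 < r" "r \<le> \<rho>" using A \<rho> by (simp_all add: r_def divide_le_eq mult_le_cancel_left1)
  obtain g where g: "inverse_branch g j b r" "g b = z"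
    using exists_inverse_branch[OF \<rho>(1) end_le far] unfolding b_def r_def by metis
  have bound: "cmod (g x) \<le> escape_radius" if "x \<in> ball b r" for x
  proof (rule ccontr)
    assume "\<not> ?thesis"
    then have "escape_radius < cmod ((f ^^ j) (g x))" by (intro escape_iterate) simp
    also have "(f ^^ j) (g x) = x" using g(1) that by (simp add: inverse_branch_def)
    also have "cmod x < 2"
      using that r \<rho> end_le norm_triangle_sub[of x b] by (simp add: b_def dist_norm norm_minus_commute)
    finally show False using escape_radius_ge_2 by simp
  qed
  have sub: "cball b (r / 2) \<subseteq> ball b r" using r by auto
  have "cmod ((deriv ^^ 1) g b) \<le> fact 1 * escape_radius / (r / 2) ^ 1"
  proof (rule Cauchy_inequality)
    have hol: "g holomorphic_on ball b r" using g by (simp add: inverse_branch_def)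
    show "g holomorphic_on ball b (r / 2)"
      using hol sub ball_subset_cball by (meson holomorphic_on_subset subset_trans)
    show "continuous_on (cball b (r / 2)) g"
      using hol sub by (meson holomorphic_on_imp_continuous_on holomorphic_on_subset)
    show "cmod (g x) \<le> escape_radius" if "cmod (b - x) = r / 2" for x
      using that r by (intro bound) (simp add: dist_norm)
  qed (use r in auto)
  then have dg: "cmod (deriv g b) \<le> 2 * escape_radius / r" by (simp add: mult.commute)
  have "1 = cmod (deriv (f ^^ j) z) * cmod (deriv g b)"
    using inverse_branch_deriv[OF g(1) r(1)] by (simp add: g(2) flip: norm_mult)
  also have "\<dots> \<le> cmod (deriv (f ^^ j) z) * (2 * escape_radius / r)"
    by (intro mult_left_mono dg) auto
  finally have "r / (2 * escape_radius) \<le> cmod (deriv (f ^^ j) z)"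
    using r escape_radius_ge_2 by (simp add: divide_simps split: if_splits)
  then show ?thesis by (simp add: r_def mult.commute)
qed

text \<open>Pull back only to \<open>f z\<close>: the omitted value near \<open>c\<close> bounds the
  branch derivative by \<open>shrink * \<rho> ^ d / r\<close> with \<open>\<rho> = cmod z\<close>.
  The first step contributes at least \<open>\<rho> ^ (d - 1)\<close>, and \<open>r\<close> is
  proportional to \<open>\<rho>\<close>, so all powers of \<open>\<rho>\<close> cancel. The bound
  thus does not degenerate as \<open>z\<close> nears 0, and blocks can be multiplied.\<close>

lemma deriv_lower_bound_near:
  assumes j: "0 < j" and z: "z \<noteq> 0" and end_le: "cmod ((f ^^ j) z) \<le> cmod z"
    and far: "\<And>i. i < j \<Longrightarrow> cmod z \<le> cmod ((f ^^ i) z)"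
  shows "1 / shrink ^ (returns (cmod z) (j - 1) + 1) \<le> cmod (deriv (f ^^ j) z)"
proof -
  define \<rho> where "\<rho> = cmod z"
  have \<rho>: "0 < \<rho>" using z by (simp add: \<rho>_def)
  obtain k where k: "j = Suc k" using j by (cases j) auto
  define b where "b = (f ^^ k) (f z)"
  have b: "(f ^^ j) z = b" unfolding k b_def by (rule funpow_f_shift)
  have b_le: "cmod b \<le> \<rho>" using end_le b by (simp add: \<rho>_def)
  define r where "r = \<rho> / shrink ^ returns \<rho> k"
  have A: "shrink \<ge> 1" using shrink_ge_8 by simp
  have r: "0 < r" "r \<le> \<rho>" using A \<rho> by (simp_all add: r_def divide_le_eq mult_le_cancel_left1)
  have far': "\<rho> \<le> cmod ((f ^^ i) (f z))" if "i < k" for i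
    using far[of "Suc i"] that by (simp only: k funpow_f_shift Suc_less_eq \<rho>_def)
  obtain g where g: "inverse_branch g k b r" "g b = f z"
    using exists_inverse_branch[OF \<rho> b_le[unfolded b_def] far'] unfolding b_def r_def by metis
  obtain w where w: "w \<notin> g ` ball b r" "cmod (w - c) \<le> 2 ^ d * \<rho> ^ d"
    using inverse_branch_omits[OF g(1) \<rho> r(2) b_le] .
  have kpos: "koebe_const \<ge> 1" by (rule koebe_const_ge_1)
  have "cmod (g b - w) \<le> cmod (f z - c) + cmod (w - c)"
    using norm_triangle_ineq4[of "f z - c" "w - c"] g(2) by simp
  also have "\<dots> \<le> \<rho> ^ d + 2 ^ d * \<rho> ^ d"
    using w(2) by (simp add: norm_f_minus_c \<rho>_def)
  also have "\<dots> \<le> 2 ^ d * \<rho> ^ d + 2 ^ d * \<rho> ^ d"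
    using \<rho> by (simp add: mult_le_cancel_right1)
  finally have gw: "cmod (g b - w) \<le> 2 * 2 ^ d * \<rho> ^ d" by (simp add: algebra_simps)
  have "cmod (deriv g b) \<le> koebe_const * cmod (g b - w) / r"
    using g(1) r w(1) by (intro univalent_deriv_bound inverse_branch_inj) (auto simp: inverse_branch_def)
  also have "\<dots> \<le> koebe_const * (2 * 2 ^ d * \<rho> ^ d) / r"
    using kpos r gw by (intro divide_right_mono mult_left_mono) auto
  also have "\<dots> \<le> shrink * \<rho> ^ d / r"
    using kpos r \<rho> by (intro divide_right_mono) (auto simp: shrink_def)
  finally have dg: "cmod (deriv g b) \<le> shrink * \<rho> ^ d / r" .
  have "1 = cmod (deriv (f ^^ k) (f z)) * cmod (deriv g b)"
    using inverse_branch_deriv[OF g(1) r(1)] by (simp add: g(2) flip: norm_mult)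
  also have "\<dots> \<le> cmod (deriv (f ^^ k) (f z)) * (shrink * \<rho> ^ d / r)"
    by (intro mult_left_mono dg) auto
  finally have "1 / (shrink * \<rho> ^ d / r) \<le> cmod (deriv (f ^^ k) (f z))"
    using A \<rho> r by (subst pos_divide_le_eq) auto
  moreover have "\<rho> ^ (d - 1) \<le> cmod (deriv f z)"
    using d_ge_2 \<rho> by (simp add: deriv_f norm_mult norm_power \<rho>_def)
  ultimately have "1 / (shrink * \<rho> ^ d / r) * \<rho> ^ (d - 1)
      \<le> cmod (deriv (f ^^ k) (f z)) * cmod (deriv f z)"
    using \<rho> by (intro mult_mono) auto
  also have "\<dots> = cmod (deriv (f ^^ j) z)"
    using deriv_iterate_add[of k 1 z] by (simp add: k norm_mult)
  also have "1 / (shrink * \<rho> ^ d / r) * \<rho> ^ (d - 1) = r / (shrink * \<rho>)"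
  proof -
    have "\<rho> ^ d = \<rho> * \<rho> ^ (d - 1)" using d_ge_2 by (simp flip: power_Suc)
    then show ?thesis using \<rho> by simp
  qed
  also have "r / (shrink * \<rho>) = 1 / shrink ^ (returns \<rho> k + 1)"
    using \<rho> by (simp add: r_def)
  finally show ?thesis by (simp add: k \<rho>_def del: funpow.simps)
qed

section \<open>Rarity of returns near the critical point\<close>

lemma returns_mono:
  assumes "\<rho> \<le> \<rho>'"
  shows "returns \<rho> j \<le> returns \<rho>' j"
  unfolding returns_def using assms by (intro card_mono) auto

text \<open>Stated for every point of the disc rather than for 0 alone, so that it separates
  successive returns of the critical orbit and also bounds block lengths from below.\<close>

definition late_return :: "nat \<Rightarrow> real \<Rightarrow> bool" where
  "late_return K \<delta> \<longleftrightarrow> (\<forall>u i. cmod u < 2 * \<delta> \<and> 1 \<le> i \<and> i < K \<longrightarrow> 2 * \<delta> \<le> cmod ((f ^^ i) u))"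

lemma late_returnD:
  assumes "late_return K \<delta>" "cmod u < 2 * \<delta>" "1 \<le> i" "cmod ((f ^^ i) u) < 2 * \<delta>"
  shows "K \<le> i"
  using assms unfolding late_return_def by (meson not_le)

text \<open>Since 0 is not periodic, continuity lets each of the finitely many relevant iterates
  move a small disc about 0 off itself.\<close>

lemma exists_late_return:
  obtains \<delta> where "0 < \<delta>" "\<delta> \<le> 1" "late_return K \<delta>"
proof -
  have "\<exists>\<delta>. 0 < \<delta> \<and> \<delta> \<le> 1 \<and> late_return K \<delta>"
  proof (induction K)
    case 0
    show ?case by (rule exI[of _ 1]) (simp add: late_return_def)
  next
    case (Suc K)
    then obtain \<delta> where \<delta>: "0 < \<delta>" "\<delta> \<le> 1" "late_return K \<delta>" by blast
    obtain e where e: "0 < e" "\<And>u. cmod u < 2 * e \<Longrightarrow> 1 \<le> K \<Longrightarrow> 2 * e \<le> cmod ((f ^^ K) u)"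
    proof (cases "K = 0")
      case True
      then show ?thesis using that[of 1] by simp
    next
      case False
      define p where "p = cmod ((f ^^ K) 0)"
      have p: "p > 0" using critical_point_not_periodic False by (simp add: p_def)
      have "isCont (f ^^ K) 0"
        using holomorphic_on_imp_continuous_on[OF funpow_holomorphic, of K]
        by (simp add: continuous_on_eq_continuous_at)
      then have "isCont (\<lambda>u. cmod ((f ^^ K) u)) 0" by (rule isCont_norm)
      then obtain s where s: "s > 0" "\<And>u. cmod u < s \<Longrightarrow> \<bar>cmod ((f ^^ K) u) - p\<bar> < p / 2"
        using p unfolding continuous_at_eps_delta dist_norm p_def
        by (metis diff_zero half_gt_zero real_norm_def)
      show ?thesis
      \<comment> \<open>The first entry gives \<open>cmod u < s\<close>, hence an image of modulus
        above \<open>p / 2\<close>; the second makes twice the radius at most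
        \<open>p / 2\<close>.\<close>
      proof (rule that[of "min (s / 2) (p / 4)"])
        show "2 * min (s / 2) (p / 4) \<le> cmod ((f ^^ K) u)" if "cmod u < 2 * min (s / 2) (p / 4)" for u
        proof -
          have "cmod u < s" using that by linarith
          from s(2)[OF this] show ?thesis by linarith
        qed
      qed (use s p in auto)
    qed
    define \<delta>' where "\<delta>' = min \<delta> e"
    have "late_return (Suc K) \<delta>'"
      unfolding late_return_def
    proof (intro allI impI)
      fix u i assume ui: "cmod u < 2 * \<delta>' \<and> 1 \<le> i \<and> i < Suc K"
      then have u: "cmod u < 2 * \<delta>" "cmod u < 2 * e" by (auto simp: \<delta>'_def)
      show "2 * \<delta>' \<le> cmod ((f ^^ i) u)"
      proof (cases "i = K")
        case True
        then show ?thesis using e(2)[OF u(2)] ui by (simp add: \<delta>'_def min_le_iff_disj)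
      next
        case False
        then have "2 * \<delta> \<le> cmod ((f ^^ i) u)"
          using \<delta>(3) u ui unfolding late_return_def by auto
        then show ?thesis by (simp add: \<delta>'_def)
      qed
    qed
    then show ?case using \<delta> e by (intro exI[of _ \<delta>']) (auto simp: \<delta>'_def)
  qed
  then show thesis using that by blast
qed

text \<open>The orbit starts at 0, so the first return takes at least \<open>K\<close> steps, and so
  does each later one. The induction removes a final window of length \<open>K\<close>, which holds
  at most one return.\<close>

lemma returns_le:
  assumes \<delta>: "0 < \<delta>" "late_return K \<delta>" and K: "K > 0"
  shows "returns \<delta> j * K \<le> j"
proof (induction j rule: less_induct)
  case (less j)
  define S where "S = {i \<in> {1..j}. cmod ((f ^^ i) 0) < 2 * \<delta>}"
  show ?case
  proof (cases "j < K")
    case True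
    have "S = {}"
    proof -
      have False if "i \<in> S" for i
        using late_returnD[OF \<delta>(2), of 0 i] that \<delta>(1) True by (auto simp: S_def)
      then show ?thesis by blast
    qed
    moreover have "returns \<delta> j = card S" by (simp add: returns_def S_def)
    ultimately show ?thesis by simp
  next
    case False
    define T where "T = S \<inter> {j - K<..j}"
    have gap: "i = i'" if "i \<in> T" "i' \<in> T" "i \<le> i'" for i i'
    proof (rule ccontr)
      assume "i \<noteq> i'"
      then have "1 \<le> i' - i" using that by simp
      moreover have "(f ^^ (i' - i)) ((f ^^ i) 0) = (f ^^ (i' - i + i)) 0"
        by (simp only: funpow_add comp_apply)
      then have "(f ^^ (i' - i)) ((f ^^ i) 0) = (f ^^ i') 0" using that(3) by simp
      ultimately have "K \<le> i' - i"
        using late_returnD[OF \<delta>(2), of "(f ^^ i) 0" "i' - i"] that by (simp add: T_def S_def)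
      moreover have "i' - i < K" using that False by (auto simp: T_def)
      ultimately show False by simp
    qed
    have "finite T" by (simp add: T_def S_def)
    then have "card T \<le> 1"
      using gap by (metis One_nat_def card_le_Suc0_iff_eq linear)
    moreover have "card S \<le> returns \<delta> (j - K) + card T"
    proof -
      define R where "R = {i \<in> {1..j - K}. cmod ((f ^^ i) 0) < 2 * \<delta>}"
      have "card S \<le> card (R \<union> T)"
        by (rule card_mono) (auto simp: S_def T_def R_def)
      also have "\<dots> \<le> card R + card T" by (rule card_Un_le)
      finally show ?thesis by (simp add: returns_def R_def)
    qed
    ultimately have "returns \<delta> j \<le> returns \<delta> (j - K) + 1" by (simp add: returns_def S_def)
    then have "returns \<delta> j * K \<le> returns \<delta> (j - K) * K + K"
      using mult_le_mono1[of "returns \<delta> j" "returns \<delta> (j - K) + 1" K] by simp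
    also have "\<dots> \<le> (j - K) + K" using less[of "j - K"] K False by simp
    finally show ?thesis using False by simp
  qed
qed

section \<open>Assembling the blocks into an exponential lower bound\<close>

lemma shrink_power_le:
  assumes K: "K > 0" and "n * K \<le> q * m"
  shows "shrink powr (- (real q * real m / real K)) \<le> 1 / shrink ^ n"
proof -
  have "real n * real K \<le> real q * real m"
    using assms(2) by (metis of_nat_le_iff of_nat_mult)
  then have "real n \<le> real q * real m / real K" using K by (simp add: le_divide_eq)
  then have "shrink powr (- (real q * real m / real K)) \<le> shrink powr (- real n)"
    using shrink_ge_8 by (intro powr_mono) auto
  then show ?thesis using shrink_ge_8 by (simp add: powr_minus powr_realpow divide_inverse)
qed

text \<open>The orbit is cut at its closest approach to the critical point, so that the block after
  the cut starts at that distance and never comes closer before its end.\<close>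

lemma deriv_lower_bound:
  assumes \<delta>: "0 < \<delta>" "\<delta> \<le> 1" "late_return K \<delta>" and K: "K > 0"
    and "cmod ((f ^^ m) z) < \<delta>" "\<And>i. i < m \<Longrightarrow> cmod ((f ^^ m) z) \<le> cmod ((f ^^ i) z)"
  shows "\<delta> / (2 * escape_radius) * shrink powr (- (2 * real m / real K)) \<le> cmod (deriv (f ^^ m) z)"
  using assms(5,6)
proof (induction m rule: less_induct)
  case (less m)
  define \<kappa> where "\<kappa> = \<delta> / (2 * escape_radius)"
  have \<kappa>: "\<kappa> > 0" using \<delta> escape_radius_ge_2 by (simp add: \<kappa>_def)
  show ?case
  proof (cases "\<exists>i<m. cmod ((f ^^ i) z) < \<delta>")
    case False
    \<comment> \<open>The orbit stays outside the \<open>\<delta>\<close>-disc until its end. This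
      initial block is the only one that costs the constant \<open>\<kappa>\<close>.\<close>
    have "returns \<delta> m * K \<le> 2 * m"
      using returns_le[OF \<delta>(1,3) K, of m] by simp
    then have "\<kappa> * shrink powr (- (2 * real m / real K)) \<le> \<kappa> * (1 / shrink ^ returns \<delta> m)"
      using \<kappa> shrink_power_le[OF K, of "returns \<delta> m" 2 m] by (intro mult_left_mono) auto
    also have "\<dots> = \<kappa> / shrink ^ returns \<delta> m" by simp
    also have "\<dots> \<le> cmod (deriv (f ^^ m) z)"
      unfolding \<kappa>_def
    proof (rule deriv_lower_bound_far[OF \<delta>(1,2)])
      show "\<delta> \<le> cmod ((f ^^ i) z)" if "i < m" for i
        using False that by (meson not_less)
    qed (use less.prems(1) in simp)
    finally show ?thesis by (simp add: \<kappa>_def)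
  next
    case True
    then obtain i where i: "i < m" "cmod ((f ^^ i) z) < \<delta>" by blast
    \<comment> \<open>Minimality serves twice: the part up to \<open>t\<close> ends at its closest
      approach, as the induction hypothesis requires, and the block from \<open>t\<close> to
      \<open>m\<close> never comes closer than its start before its end.\<close>
    obtain t where t: "t < m" "\<And>i. i < m \<Longrightarrow> cmod ((f ^^ t) z) \<le> cmod ((f ^^ i) z)"
      using ex_min_if_finite[of "(\<lambda>i. cmod ((f ^^ i) z)) ` {..<m}"] i(1) by force
    define y where "y = (f ^^ t) z"
    define j where "j = m - t"
    have m: "m = j + t" and j: "j > 0" using t(1) by (auto simp: j_def)
    have it: "(f ^^ i) y = (f ^^ (i + t)) z" for i by (simp add: y_def funpow_add)
    have y_lt: "cmod y < \<delta>" using t(2)[OF i(1)] i(2) by (simp add: y_def)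
    have end_le: "cmod ((f ^^ j) y) \<le> cmod y"
      using less.prems(2)[OF t(1)] unfolding it unfolding m y_def .
    \<comment> \<open>Otherwise \<open>end_le\<close> would make 0 periodic.\<close>
    have y0: "y \<noteq> 0"
      using end_le critical_point_not_periodic[OF j] by auto
    have "K \<le> j"
      using \<delta> y_lt end_le j by (intro late_returnD[of K \<delta> y]) auto
    moreover have "returns (cmod y) (j - 1) * K \<le> j"
    proof -
      have "returns (cmod y) (j - 1) * K \<le> returns \<delta> (j - 1) * K"
        using y_lt by (intro mult_le_mono1 returns_mono) simp
      also have "\<dots> \<le> j - 1" by (rule returns_le[OF \<delta>(1,3) K])
      finally show ?thesis by simp
    qed
    \<comment> \<open>Returns account for at most \<open>j / K\<close> factors, and
      \<open>K \<le> j\<close> pays for the additional factor of the block; hence the 2 in the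
      exponent.\<close>
    ultimately have "(returns (cmod y) (j - 1) + 1) * K \<le> 2 * j" by (simp add: algebra_simps)
    then have "shrink powr (- (2 * real j / real K)) \<le> 1 / shrink ^ (returns (cmod y) (j - 1) + 1)"
      by (rule shrink_power_le[OF K, where q = 2, unfolded of_nat_numeral])
    also have "\<dots> \<le> cmod (deriv (f ^^ j) y)"
    proof (rule deriv_lower_bound_near[OF j y0 end_le])
      show "cmod y \<le> cmod ((f ^^ i) y)" if "i < j" for i
        using t(2)[of "i + t"] that by (simp add: it m) (simp add: y_def)
    qed
    finally have block: "shrink powr (- (2 * real j / real K)) \<le> cmod (deriv (f ^^ j) y)" .
    have "\<kappa> * shrink powr (- (2 * real t / real K)) \<le> cmod (deriv (f ^^ t) z)"
      unfolding \<kappa>_def using t y_lt by (intro less.IH) (auto simp: y_def)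
    with block have "shrink powr (- (2 * real j / real K)) * (\<kappa> * shrink powr (- (2 * real t / real K)))
        \<le> cmod (deriv (f ^^ j) y) * cmod (deriv (f ^^ t) z)"
      using \<kappa> by (intro mult_mono) auto
    also have "\<dots> = cmod (deriv (f ^^ m) z)"
      unfolding m deriv_iterate_add y_def norm_mult ..
    also have "shrink powr (- (2 * real j / real K)) * (\<kappa> * shrink powr (- (2 * real t / real K)))
        = \<kappa> * shrink powr (- (2 * real m / real K))"
      by (simp add: m add_divide_distrib algebra_simps flip: powr_add)
    finally show ?thesis by (simp add: \<kappa>_def)
  qed
qed

lemma exponential_lower_bound:
  assumes "\<epsilon> > 0"
  obtains \<kappa> where "\<kappa> > 0"
    "\<And>m z. (f ^^ m) z = 0 \<Longrightarrow> \<kappa> * exp (- \<epsilon> * real m) \<le> cmod (deriv (f ^^ m) z)"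
proof -
  \<comment> \<open>The rate of loss is \<open>2 * ln shrink / K\<close>, so this \<open>K\<close>
    brings it below \<open>\<epsilon>\<close>.\<close>
  obtain K :: nat where K': "2 * ln shrink / \<epsilon> < real K" using reals_Archimedean2 by blast
  have ln: "ln shrink > 0" using shrink_ge_8 by simp
  have "0 < 2 * ln shrink / \<epsilon>" using ln assms by simp
  with K' have K: "K > 0" by (metis of_nat_0_less_iff less_trans)
  obtain \<delta> where \<delta>: "0 < \<delta>" "\<delta> \<le> 1" "late_return K \<delta>" using exists_late_return .
  define \<kappa> where "\<kappa> = \<delta> / (2 * escape_radius)"
  have \<kappa>: "\<kappa> > 0" using \<delta> escape_radius_ge_2 by (simp add: \<kappa>_def)
  show thesis
  proof (rule that[OF \<kappa>])
    fix m z assume z: "(f ^^ m) z = 0"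
    have "2 * ln shrink / real K \<le> \<epsilon>" using K' K assms by (simp add: field_simps)
    then have "2 * ln shrink / real K * real m \<le> \<epsilon> * real m" by (rule mult_right_mono) simp
    then have "exp (- \<epsilon> * real m) \<le> shrink powr (- (2 * real m / real K))"
      using shrink_ge_8 by (simp add: powr_def mult_ac)
    then have "\<kappa> * exp (- \<epsilon> * real m) \<le> \<kappa> * shrink powr (- (2 * real m / real K))"
      using \<kappa> by (intro mult_left_mono) auto
    also have "\<dots> \<le> cmod (deriv (f ^^ m) z)"
      \<comment> \<open>An orbit ending at 0 trivially has its closest approach at the end.\<close>
      unfolding \<kappa>_def using z \<delta> K by (intro deriv_lower_bound) auto
    finally show "\<kappa> * exp (- \<epsilon> * real m) \<le> cmod (deriv (f ^^ m) z)" .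
  qed
qed

end

section \<open>Backward orbits and their lower exponent\<close>

lemma backward_orbit_funpow:
  assumes "backward_orbit g a x"
  shows "(g ^^ n) (x n) = a"
proof (induction n)
  case 0
  then show ?case using assms by (simp add: backward_orbit_def)
next
  case (Suc n)
  have "g (x (Suc n)) = x n" using assms by (simp add: backward_orbit_def)
  then show ?case using Suc by (simp add: funpow_swap1)
qed

theorem theorem1p6:
  fixes d :: nat and c :: complex and x :: "nat \<Rightarrow> complex"
  assumes "d \<ge> 2"
    and "\<not> has_attracting_cycle (unicrit d c)"
    and "backward_orbit (unicrit d c) 0 x"
  shows "chi_back_lower (unicrit d c) x \<ge> 0"
proof -
  interpret unicritical d c by unfold_locales (use assms in auto)
  define X where "X n = ln (cmod (deriv (f ^^ n) (x n))) / real n" for n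
  have "eventually (\<lambda>n. y < X n) sequentially" if "y < 0" for y
  proof -
    \<comment> \<open>Half of \<open>- y\<close> is spent on the exponential rate, the other half on
      \<open>ln \<kappa> / n\<close>, which tends to 0.\<close>
    define \<epsilon> where "\<epsilon> = - y / 2"
    have \<epsilon>: "\<epsilon> > 0" using that by (simp add: \<epsilon>_def)
    obtain \<kappa> where \<kappa>: "\<kappa> > 0"
      "\<And>m z. (f ^^ m) z = 0 \<Longrightarrow> \<kappa> * exp (- \<epsilon> * real m) \<le> cmod (deriv (f ^^ m) z)"
      using exponential_lower_bound[OF \<epsilon>] by blast
    have "(\<lambda>n. ln \<kappa> / real n) \<longlonglongrightarrow> 0" by (rule lim_const_over_n)
    then have "eventually (\<lambda>n. - \<epsilon> < ln \<kappa> / real n) sequentially"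
      using \<epsilon> by (intro order_tendstoD) auto
    then show ?thesis
      using eventually_gt_at_top[of 0]
    proof eventually_elim
      case (elim n)
      have "\<kappa> * exp (- \<epsilon> * real n) \<le> cmod (deriv (f ^^ n) (x n))"
        by (rule \<kappa>(2)) (rule backward_orbit_funpow[OF assms(3)])
      \<comment> \<open>Positivity also excludes a vanishing derivative, at which \<open>ln\<close>
        would only return its default value.\<close>
      moreover have "0 < \<kappa> * exp (- \<epsilon> * real n)" using \<kappa>(1) by simp
      ultimately have "ln (\<kappa> * exp (- \<epsilon> * real n)) \<le> ln (cmod (deriv (f ^^ n) (x n)))"
        by (rule ln_mono)
      then have "ln \<kappa> - \<epsilon> * real n \<le> ln (cmod (deriv (f ^^ n) (x n)))"
        using \<kappa>(1) by (simp add: ln_mult)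
      then have "(ln \<kappa> - \<epsilon> * real n) / real n \<le> X n"
        unfolding X_def by (rule divide_right_mono) simp
      then have "ln \<kappa> / real n - \<epsilon> \<le> X n" using elim by (simp add: diff_divide_distrib)
      then show "y < X n" using elim(1) unfolding \<epsilon>_def by linarith
    qed
  qed
  then have "eventually (\<lambda>n. y < ereal (X n)) sequentially" if "y < 0" for y :: ereal
    using that by (cases y) auto
  then have "0 \<le> liminf (\<lambda>n. ereal (X n))"
    unfolding le_Liminf_iff by blast
  then show ?thesis unfolding chi_back_lower_def X_def .
qed

end
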